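(* Let $m\ge 1$ and let $c_1,\dots,c_m$ be positive integers. Let $\vec x=(x_1,\dots,x_m)$ be a random vector uniformly distributed on the domain $$\{\vec x\in\mathbb{R}^m : x_1\ge x_2\ge\cdots\ge x_m>0,\ c_1x_1+c_2x_2+\cdots+c_mx_m=1\}.$$ Then the mean $R_{m,k}=E(x_k)$ is given by $$R_{m,k}=\frac1m\sum_{j=k}^{m}\frac{1}{c_1+\cdots+c_j},\qquad 1\le k\le m.$$
   Context: Interpretation: $n$ co-authors are divided into $m\le n$ groups, the $i$-th group has $c_i$ co-authors, each with the same credit $x_i$. Uniform distribution on the domain means: $\bar x(m)=(x_2,\dots,x_m)$ is uniformly distributed with respect to Lebesgue measure on $$\Omega_m=\Big\{(x_2,\dots,x_m)\in\mathbb{R}^{m-1}: 0\le x_m\le x_{m-1}\le\cdots\le x_2\le \tfrac1{c_1}\big(1-\sum_{i=2}^m c_ix_i\big)\Big\},$$ with $x_1=\frac1{c_1}\big(1-\sum_{i=2}^m c_ix_i\big)$ (the boundary $x_m=0$ has measure zero). Equivalently, with $M_m=\int_{\Omega_m}d\bar x(m)$ and $E_{m,k}=\int_{\Omega_m}x_k\,d\bar x(m)$, one has $R_{m,k}=E(x_k)=E_{m,k}/M_m$. For $m=1$ the domain is the single point $x_1=1/c_1$ and the distribution is the point mass there. *)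

theory Defs
  imports "HOL-Probability.Probability"
begin

text \<open>
  Vectors with coordinates indexed by a finite set \<open>I\<close> of natural numbers are
  the extensional functions \<open>I \<rightarrow>\<^sub>E UNIV\<close>, and Lebesgue measure on them is the
  product \<open>\<Pi>\<^sub>M i\<in>I. lborel\<close>. The values of \<open>c\<close> outside \<open>{1..m}\<close> are irrelevant.
\<close>

definition credit_domain :: "nat \<Rightarrow> (nat \<Rightarrow> nat) \<Rightarrow> (nat \<Rightarrow> real) set" where
  "credit_domain m c =
    {x \<in> {1..m} \<rightarrow>\<^sub>E UNIV.
       (\<forall>i\<in>{1..<m}. x i \<ge> x (Suc i)) \<and> x m > 0 \<and> (\<Sum>i=1..m. real (c i) * x i) = 1}"

definition first_credit :: "nat \<Rightarrow> (nat \<Rightarrow> nat) \<Rightarrow> (nat \<Rightarrow> real) \<Rightarrow> real" where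
  "first_credit m c y = 1 / real (c 1) * (1 - (\<Sum>i=2..m. real (c i) * y i))"

text \<open>
  The set \<open>\<Omega>\<^sub>m\<close> of all \<open>(y\<^sub>2, \<dots>, y\<^sub>m)\<close> with
  \<open>0 \<le> y\<^sub>m \<le> \<dots> \<le> y\<^sub>2 \<le> first_credit m c y\<close>. Putting the last bound into coordinate 1
  also covers \<open>m = 1\<close>: there the index set \<open>{2..m}\<close> is empty, the product measure is
  the point mass at the only extensional function, and \<open>\<Omega>\<^sub>1\<close> consists of that point.
\<close>

definition credit_Omega :: "nat \<Rightarrow> (nat \<Rightarrow> nat) \<Rightarrow> (nat \<Rightarrow> real) set" where
  "credit_Omega m c =
    {y \<in> {2..m} \<rightarrow>\<^sub>E UNIV.
       let x = y(1 := first_credit m c y)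
       in 0 \<le> x m \<and> (\<forall>i\<in>{1..<m}. x (Suc i) \<le> x i)}"

text \<open>
  The domain lies in a hyperplane, so uniformity refers to the coordinates
  \<open>x\<^sub>2, \<dots>, x\<^sub>m\<close>; the coordinate \<open>x\<^sub>1\<close> is then determined almost surely by membership in
  the domain. The domain requires \<open>x\<^sub>m > 0\<close> while \<open>\<Omega>\<^sub>m\<close> allows \<open>x\<^sub>m = 0\<close>; the
  difference is a null set.
\<close>

definition uniform_on_credit_domain ::
    "'a measure \<Rightarrow> ('a \<Rightarrow> nat \<Rightarrow> real) \<Rightarrow> nat \<Rightarrow> (nat \<Rightarrow> nat) \<Rightarrow> bool" where
  "uniform_on_credit_domain M X m c \<longleftrightarrow>
     X \<in> measurable M (\<Pi>\<^sub>M i\<in>{1..m}. borel) \<and>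
     (AE \<omega> in M. X \<omega> \<in> credit_domain m c) \<and>
     distr M (\<Pi>\<^sub>M i\<in>{2..m}. lborel) (\<lambda>\<omega>. restrict (X \<omega>) {2..m}) =
       uniform_measure (\<Pi>\<^sub>M i\<in>{2..m}. lborel) (credit_Omega m c)"

end

theory Submission imports Defs begin

text \<open>
  Write \<open>C\<^sub>j = c\<^sub>1 + \<dots> + c\<^sub>j\<close>. In the coordinates \<open>t\<^sub>j = C\<^sub>j (x\<^sub>j - x\<^sub>j\<^sub>+\<^sub>1)\<close>, where
  \<open>x\<^sub>m\<^sub>+\<^sub>1 = 0\<close>, the domain \<open>\<Omega>\<^sub>m\<close> becomes the standard simplex \<open>t\<^sub>j \<ge> 0\<close>,
  \<open>t\<^sub>2 + \<dots> + t\<^sub>m \<le> 1\<close>, and \<open>x\<^sub>k = \<Sum>j\<ge>k. t\<^sub>j / C\<^sub>j\<close>. This map is triangular, so by Fubini it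
  scales Lebesgue measure by a constant, and each \<open>t\<^sub>j\<close> has mean \<open>1/m\<close> on the simplex. This
  gives the means for \<open>k \<ge> 2\<close>; the mean of \<open>x\<^sub>1\<close> follows from \<open>\<Sum>i. c\<^sub>i x\<^sub>i = 1\<close>, since the
  claimed values satisfy the same linear relation.
\<close>

section \<open>Change of variables by a triangular map\<close>

interpretation lborel_prod: product_sigma_finite "\<lambda>_::nat. lborel :: real measure"
  by standard

text \<open>Downward induction on \<open>n\<close>. With the later coordinates fixed, coordinate
  \<open>n\<close> of the image is the next coordinate plus \<open>t n / C n\<close>, so Fubini
  reduces the step to an affine substitution in one real variable, which contributes the factor
  \<open>1 / C n\<close>. The function \<open>f\<close> stays arbitrary because the induction
  hypothesis is applied to a partial integral of \<open>f\<close>.\<close>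

lemma nn_integral_shear:
  fixes C :: "nat \<Rightarrow> real" and f :: "(nat \<Rightarrow> real) \<Rightarrow> ennreal"
  assumes "n \<le> Suc m"
    and "\<And>j. j \<in> {n..m} \<Longrightarrow> C j > 0"
    and "f \<in> borel_measurable (\<Pi>\<^sub>M i\<in>{n..m}. lborel)"
  shows "(\<integral>\<^sup>+ y. f y \<partial>(\<Pi>\<^sub>M i\<in>{n..m}. lborel)) =
    (\<Prod>j=n..m. ennreal (1 / C j)) *
    (\<integral>\<^sup>+ t. f (\<lambda>i\<in>{n..m}. \<Sum>j=i..m. t j / C j) \<partial>(\<Pi>\<^sub>M i\<in>{n..m}. lborel))"
  using assms
proof (induction n arbitrary: f rule: inc_induct)
  case base
  \<comment> \<open>Over the empty index set the product measure is the point mass at the only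
    extensional function, so both sides are the value of \<open>f\<close> there.\<close>
  have "(\<lambda>i\<in>{Suc m..m}. \<Sum>j=i..m. t j / C j) = (\<lambda>x. undefined)" for t
    by auto
  then show ?case
    by (simp add: PiM_empty nn_integral_count_space_finite)
next
  case (step n)
  note [measurable] = step.prems(2)
  have I: "{n..m} = insert n {Suc n..m}"
    using step.hyps by auto
  define P where "P = ((\<Pi>\<^sub>M i\<in>{Suc n..m}. lborel) :: (nat \<Rightarrow> real) measure)"
  \<comment> \<open>\<open>\<sigma> x\<close> is the coordinate after \<open>n\<close>; the value 0
    for \<open>n = m\<close> realizes the convention x_{m+1} = 0.\<close>
  define \<sigma> where "\<sigma> x = (if n < m then x (Suc n) else 0)" for x :: "nat \<Rightarrow> real"
  define g where "g x = (\<integral>\<^sup>+ s. f (x(n := \<sigma> x + s / C n)) \<partial>lborel)" for x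
  define T where "T n' t = (\<lambda>i\<in>{n'..m}. \<Sum>j=i..m. t j / C j)" for n' and t :: "nat \<Rightarrow> real"
  have C: "C n > 0"
    using step.prems(1) step.hyps by auto
  have meas_upd: "(\<lambda>(x, y). x(n := y)) \<in> P \<Otimes>\<^sub>M lborel \<rightarrow>\<^sub>M (\<Pi>\<^sub>M i\<in>{n..m}. lborel)"
    unfolding I P_def by (rule measurable_add_dim)
  have \<sigma>_meas [measurable]: "\<sigma> \<in> borel_measurable P"
    unfolding \<sigma>_def P_def by (cases "n < m") (auto intro!: measurable_component_singleton)
  have "(\<lambda>(x, s). (x, \<sigma> x + s / C n)) \<in> P \<Otimes>\<^sub>M lborel \<rightarrow>\<^sub>M P \<Otimes>\<^sub>M lborel"
    by measurable
  from measurable_compose[OF measurable_compose[OF this meas_upd] step.prems(2)]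
  have "(\<lambda>(x, s). f (x(n := \<sigma> x + s / C n))) \<in> borel_measurable (P \<Otimes>\<^sub>M lborel)"
    by (simp only: case_prod_beta' fst_conv snd_conv)
  then have g_meas: "g \<in> borel_measurable P"
    unfolding g_def by (rule lborel.borel_measurable_nn_integral)
  have T_meas: "T n \<in> (\<Pi>\<^sub>M i\<in>{n..m}. lborel) \<rightarrow>\<^sub>M (\<Pi>\<^sub>M i\<in>{n..m}. lborel)"
    unfolding T_def
    by (rule measurable_restrict) (auto intro!: borel_measurable_sum borel_measurable_divide measurable_component_singleton)
  have fT_meas: "(\<lambda>t. f (T n t)) \<in> borel_measurable (\<Pi>\<^sub>M i\<in>{n..m}. lborel)"
    by (rule measurable_compose[OF T_meas step.prems(2)])
  \<comment> \<open>Substitution z = \<open>\<sigma> x + s / C n\<close>; the shift depends on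
    \<open>x\<close> only, hence is constant in the inner integral.\<close>
  have inner: "(\<integral>\<^sup>+ z. f (x(n := z)) \<partial>lborel) = ennreal (1 / C n) * g x" if "x \<in> space P" for x
  proof -
    have "(\<lambda>z. f (x(n := z))) \<in> borel_measurable borel"
      using measurable_compose[OF measurable_compose[OF measurable_Pair1'[OF that] meas_upd] step.prems(2)]
      by (simp only: case_prod_conv measurable_lborel1 measurable_lborel2)
    from nn_integral_real_affine[OF this, of "1 / C n" "\<sigma> x"] C show ?thesis
      by (simp add: g_def)
  qed
  \<comment> \<open>By the recursion for tail sums, prepending the coordinate
    \<open>\<sigma> (T (Suc n) t) + s / C n\<close> to \<open>T (Suc n) t\<close> gives
    \<open>T n (t(n := s))\<close>. Hence integrating \<open>g (T (Suc n) t)\<close> is the iterated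
    form of the integral of \<open>f (T n t)\<close>.\<close>
  have gT: "g (T (Suc n) t) = (\<integral>\<^sup>+ s. f (T n (t(n := s))) \<partial>lborel)" for t
  proof -
    have "(T (Suc n) t)(n := \<sigma> (T (Suc n) t) + s / C n) = T n (t(n := s))" for s
    proof
      fix i
      have "\<sigma> (T (Suc n) t) = (\<Sum>j=Suc n..m. t j / C j)"
        by (auto simp: \<sigma>_def T_def)
      moreover have "(\<Sum>j=n..m. (t(n := s)) j / C j) = s / C n + (\<Sum>j=Suc n..m. t j / C j)"
        using step.hyps by (subst sum.atLeast_Suc_atMost) (auto intro!: sum.cong)
      ultimately show "((T (Suc n) t)(n := \<sigma> (T (Suc n) t) + s / C n)) i = T n (t(n := s)) i"
        using step.hyps by (auto simp: T_def intro!: sum.cong)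
    qed
    then show ?thesis by (simp add: g_def)
  qed
  have "(\<integral>\<^sup>+ y. f y \<partial>(\<Pi>\<^sub>M i\<in>{n..m}. lborel)) = (\<integral>\<^sup>+ x. (\<integral>\<^sup>+ z. f (x(n := z)) \<partial>lborel) \<partial>P)"
    using step.prems(2) unfolding I P_def by (subst lborel_prod.product_nn_integral_insert) auto
  also have "\<dots> = (\<integral>\<^sup>+ x. ennreal (1 / C n) * g x \<partial>P)"
    by (intro nn_integral_cong inner)
  also have "\<dots> = ennreal (1 / C n) * (\<integral>\<^sup>+ x. g x \<partial>P)"
    by (intro nn_integral_cmult g_meas)
  also have "(\<integral>\<^sup>+ x. g x \<partial>P) =
      (\<Prod>j=Suc n..m. ennreal (1 / C j)) * (\<integral>\<^sup>+ t. g (T (Suc n) t) \<partial>P)"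
    using step.prems(1) g_meas unfolding P_def T_def by (intro step.IH) auto
  also have "(\<integral>\<^sup>+ t. g (T (Suc n) t) \<partial>P) = (\<integral>\<^sup>+ t. f (T n t) \<partial>(\<Pi>\<^sub>M i\<in>{n..m}. lborel))"
    using fT_meas unfolding gT P_def I
    by (subst lborel_prod.product_nn_integral_insert) auto
  finally show ?case
    unfolding T_def using step.hyps by (subst prod.atLeast_Suc_atMost) (auto simp: mult.assoc)
qed

section \<open>Volume and first moments of the standard simplex\<close>

text \<open>The size \<open>s\<close> is a parameter because fixing one coordinate at
  \<open>y\<close> leaves a simplex of size \<open>s - y\<close>. Coordinates outside
  \<open>A\<close> are unconstrained; extensionality comes from the space of the product
  measure.\<close>

definition std_simplex :: "nat set \<Rightarrow> real \<Rightarrow> (nat \<Rightarrow> real) set" where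
  "std_simplex A s = {t. (\<forall>i\<in>A. 0 \<le> t i) \<and> sum t A \<le> s}"

lemma std_simplex_measurable [measurable]:
  assumes "finite A"
  shows "(\<lambda>t. indicator (std_simplex A s) t :: ennreal) \<in> borel_measurable (\<Pi>\<^sub>M i\<in>A. lborel)"
proof -
  have [measurable]: "Measurable.pred (\<Pi>\<^sub>M i\<in>A. lborel) (\<lambda>t. (\<forall>i\<in>A. 0 \<le> t i) \<and> sum t A \<le> s)"
    using assms by measurable
  have "(\<lambda>t. indicator (std_simplex A s) t :: ennreal) = (\<lambda>t. if (\<forall>i\<in>A. 0 \<le> t i) \<and> sum t A \<le> s then 1 else 0)"
    by (auto simp: std_simplex_def indicator_def)
  then show ?thesis by simp
qed

text \<open>The bound \<open>y \<le> s\<close> follows from nonnegativity of the other coordinates.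
  Making it explicit confines the outer integral to a compact interval on which the slice has size
  \<open>s - y \<ge> 0\<close>.\<close>

lemma indicator_std_simplex_insert:
  assumes "finite A" "a \<notin> A"
  shows "indicator (std_simplex (insert a A) s) (x(a := y)) =
    (indicator {0..s} y * indicator (std_simplex A (s - y)) x :: ennreal)"
proof -
  have "sum (x(a := y)) A = sum x A"
    using assms by (intro sum.cong) auto
  moreover have "sum x A \<ge> 0" if "\<forall>i\<in>A. 0 \<le> x i"
    using that by (intro sum_nonneg) auto
  moreover have "(\<forall>i\<in>A. 0 \<le> (x(a := y)) i) \<longleftrightarrow> (\<forall>i\<in>A. 0 \<le> x i)"
    using assms by auto
  ultimately show ?thesis
    using assms by (auto simp: std_simplex_def indicator_def)
qed

text \<open>The k-dimensional simplex of size r has volume r^k / k!, so this supplies the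
  antiderivatives for integration over slices.\<close>

lemma DERIV_power_over_fact:
  fixes s :: real
  shows "((\<lambda>y. (s - y) ^ Suc k / fact (Suc k)) has_real_derivative - ((s - y) ^ k / fact k)) (at y within A)"
proof -
  have "((\<lambda>y. s - y) has_real_derivative - 1) (at y within A)"
    by (auto intro!: derivative_eq_intros)
  from DERIV_cdivide[OF DERIV_power[OF this, of "Suc k"], of "fact (Suc k)"] show ?thesis
    by (simp add: divide_simps del: power_Suc of_nat_Suc)
qed

text \<open>Induction by slicing: each new coordinate \<open>y\<close> integrates the slice volume
  (s - y)^n / n! over [0, s]. The size is generalized since it changes from slice to slice.\<close>

lemma nn_integral_std_simplex:
  assumes "finite A" "s \<ge> 0"
  shows "(\<integral>\<^sup>+ t. indicator (std_simplex A s) t \<partial>(\<Pi>\<^sub>M i\<in>A. lborel)) = ennreal (s ^ card A / fact (card A))"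
  using assms
proof (induction A arbitrary: s rule: finite_induct)
  case empty
  then show ?case
    by (simp add: PiM_empty nn_integral_count_space_finite std_simplex_def)
next
  case (insert a A)
  let ?n = "card A"
  have "(\<integral>\<^sup>+ t. indicator (std_simplex (insert a A) s) t \<partial>(\<Pi>\<^sub>M i\<in>insert a A. lborel)) =
    (\<integral>\<^sup>+ y. (\<integral>\<^sup>+ x. indicator (std_simplex (insert a A) s) (x(a := y)) \<partial>(\<Pi>\<^sub>M i\<in>A. lborel)) \<partial>lborel)"
    using insert.hyps by (intro lborel_prod.product_nn_integral_insert_rev) auto
  also have "\<dots> = (\<integral>\<^sup>+ y. ennreal ((s - y) ^ ?n / fact ?n) * indicator {0..s} y \<partial>lborel)"
    using insert.hyps
    by (intro nn_integral_cong)
      (auto simp: indicator_std_simplex_insert nn_integral_cmult insert.IH split: split_indicator)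
  also have "\<dots> = ennreal (- ((s - s) ^ Suc ?n / fact (Suc ?n)) - - ((s - 0) ^ Suc ?n / fact (Suc ?n)))"
    using insert.prems
    by (intro nn_integral_FTC_Icc)
      (auto intro!: DERIV_cong[OF DERIV_minus[OF DERIV_power_over_fact]] simp del: fact_Suc power_Suc)
  finally show ?case
    using insert.hyps by simp
qed

text \<open>Slicing along coordinate \<open>j\<close> leaves the integral of y (s - y)^n / n! over
  [0, s]. Compared with the volume, the result says that for \<open>s = 1\<close> each coordinate
  has mean \<open>1 / Suc (card A)\<close>, which is 1/m for \<open>A = {2..m}\<close> when
  \<open>m \<ge> 2\<close>.\<close>

lemma nn_integral_std_simplex_coordinate:
  assumes "finite A" "j \<in> A" "s \<ge> 0"
  shows "(\<integral>\<^sup>+ t. ennreal (t j) * indicator (std_simplex A s) t \<partial>(\<Pi>\<^sub>M i\<in>A. lborel)) =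
    ennreal (s ^ Suc (card A) / fact (Suc (card A)))"
proof -
  define B where "B = A - {j}"
  have B: "A = insert j B" "j \<notin> B" "finite B"
    using assms by (auto simp: B_def)
  let ?n = "card B"
  \<comment> \<open>Antiderivative of y (s - y)^n / n! obtained by integration by parts; it vanishes
    at \<open>y = s\<close>.\<close>
  define F where "F y = - (y * ((s - y) ^ Suc ?n / fact (Suc ?n)) + (s - y) ^ Suc (Suc ?n) / fact (Suc (Suc ?n)))" for y
  have "(\<integral>\<^sup>+ t. ennreal (t j) * indicator (std_simplex (insert j B) s) t \<partial>(\<Pi>\<^sub>M i\<in>insert j B. lborel)) =
    (\<integral>\<^sup>+ y. (\<integral>\<^sup>+ x. ennreal ((x(j := y)) j) * indicator (std_simplex (insert j B) s) (x(j := y))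
       \<partial>(\<Pi>\<^sub>M i\<in>B. lborel)) \<partial>lborel)"
    using B by (intro lborel_prod.product_nn_integral_insert_rev) auto
  also have "\<dots> = (\<integral>\<^sup>+ y. ennreal (y * ((s - y) ^ ?n / fact ?n)) * indicator {0..s} y \<partial>lborel)"
    using B(2,3)
    by (intro nn_integral_cong)
      (auto simp: indicator_std_simplex_insert nn_integral_cmult nn_integral_std_simplex
         simp flip: ennreal_mult split: split_indicator)
  also have "\<dots> = ennreal (F s - F 0)"
  proof (rule nn_integral_FTC_Icc[where F = F])
    fix y assume y: "y \<in> {0..s}"
    show "(F has_real_derivative y * ((s - y) ^ ?n / fact ?n)) (at y)"
      unfolding F_def by (rule derivative_eq_intros DERIV_power_over_fact refl)+ simp
    show "0 \<le> y * ((s - y) ^ ?n / fact ?n)"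
      using y by simp
  qed (use assms in auto)
  finally show ?thesis
    using B by (simp add: F_def)
qed

section \<open>The domain in simplex coordinates\<close>

text \<open>Both sides sum \<open>h i * g j\<close> over the pairs with a \<le> i \<le> j \<le> m.
  With \<open>h = c\<close> the inner sums become partial sums of \<open>c\<close>, both for the
  constraint in the coordinates \<open>t\<close> and for the claimed means.\<close>

lemma sum_triangle_swap:
  fixes g h :: "nat \<Rightarrow> 'a::comm_semiring_1"
  shows "(\<Sum>i=a..m. h i * (\<Sum>j=i..m. g j)) = (\<Sum>j=a..m. (\<Sum>i=a..j. h i) * g j)"
proof (induction m)
  case 0
  then show ?case by (cases "a = 0") auto
next
  case (Suc m)
  show ?case
  proof (cases "a \<le> Suc m")
    case True
    have "(\<Sum>i=a..Suc m. h i * (\<Sum>j=i..Suc m. g j)) =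
        (\<Sum>i=a..m. h i * (\<Sum>j=i..m. g j) + h i * g (Suc m)) + h (Suc m) * g (Suc m)"
      using True by (simp add: distrib_left)
    also have "\<dots> = (\<Sum>j=a..Suc m. (\<Sum>i=a..j. h i) * g j)"
      using True by (simp add: sum.distrib Suc.IH algebra_simps flip: sum_distrib_left sum_distrib_right)
    finally show ?thesis .
  qed auto
qed

lemma initial_sum_pos:
  fixes c :: "nat \<Rightarrow> nat"
  assumes "c 1 > 0" "j \<ge> 1"
  shows "real (\<Sum>i=1..j. c i) > 0"
proof -
  have "c 1 \<le> (\<Sum>i=1..j. c i)"
    using assms(2) by (intro member_le_sum) auto
  then show ?thesis
    using assms(1) by (simp del: of_nat_sum)
qed

text \<open>Consecutive coordinates from index 2 on differ by \<open>t i / C i\<close>, so their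
  ordering amounts to \<open>t i \<ge> 0\<close>. For \<open>m \<ge> 2\<close> the first credit
  exceeds x_2 by (1 - (t_2 + ... + t_m)) / c_1, so the remaining inequality bounds the sum of
  \<open>t\<close> by 1.\<close>

lemma credit_Omega_iff_std_simplex:
  fixes c :: "nat \<Rightarrow> nat" and t :: "nat \<Rightarrow> real"
  defines "C \<equiv> \<lambda>j. real (\<Sum>i=1..j. c i)"
  assumes "m \<ge> 1" and c: "\<And>i. i \<in> {1..m} \<Longrightarrow> c i > 0"
  shows "(\<lambda>i\<in>{2..m}. \<Sum>j=i..m. t j / C j) \<in> credit_Omega m c \<longleftrightarrow> t \<in> std_simplex {2..m} 1"
proof -
  define y where "y = (\<lambda>i\<in>{2..m}. \<Sum>j=i..m. t j / C j)"
  define x where "x = y(1 := first_credit m c y)"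
  have c1: "c 1 > 0"
    using c assms(2) by auto
  have C: "C j = real (c 1) + (\<Sum>i=2..j. real (c i))" if "j \<ge> 1" for j
    using that by (simp add: C_def sum.atLeast_Suc_atMost numeral_2_eq_2)
  have C_pos: "C j > 0" if "j \<ge> 1" for j
    unfolding C_def using that c1 by (intro initial_sum_pos)
  have "(\<Sum>i=2..m. real (c i) * y i) = (\<Sum>i=2..m. real (c i) * (\<Sum>j=i..m. t j / C j))"
    by (simp add: y_def)
  also have "\<dots> = (\<Sum>j=2..m. (\<Sum>i=2..j. real (c i)) * (t j / C j))"
    by (rule sum_triangle_swap)
  \<comment> \<open>The inner sum starts at 2 and so equals \<open>C j - c 1\<close>: the part
    \<open>C j\<close> cancels the denominator, and the part \<open>c 1\<close> reassembles a
    multiple of the tail sum from 2.\<close>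
  also have "\<dots> = (\<Sum>j=2..m. t j - real (c 1) * (t j / C j))"
  proof (rule sum.cong)
    fix j assume "j \<in> {2..m}"
    then have "(\<Sum>i=2..j. real (c i)) = C j - real (c 1)" "C j \<noteq> 0"
      using C[of j] C_pos[of j] by auto
    then show "(\<Sum>i=2..j. real (c i)) * (t j / C j) = t j - real (c 1) * (t j / C j)"
      by (simp add: left_diff_distrib diff_divide_distrib)
  qed simp
  also have "\<dots> = sum t {2..m} - real (c 1) * (\<Sum>j=2..m. t j / C j)"
    by (simp add: sum_subtractf sum_distrib_left)
  finally have x1: "x 1 = (1 - sum t {2..m}) / real (c 1) + (\<Sum>j=2..m. t j / C j)"
    using c1 by (simp add: x_def first_credit_def field_simps)
  have xi: "x i = (\<Sum>j=i..m. t j / C j)" if "i \<in> {2..m}" for i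
    using that by (auto simp: x_def y_def)
  have step: "x (Suc i) \<le> x i \<longleftrightarrow> 0 \<le> t i" if "i \<in> {2..<m}" for i
    using that C_pos[of i] by (simp add: xi sum.atLeast_Suc_atMost[of i m] zero_le_divide_iff)
  have step1: "x (Suc 1) \<le> x 1 \<longleftrightarrow> sum t {2..m} \<le> 1" if "m \<ge> 2"
    using that c1 by (simp add: x1 xi[of 2] numeral_2_eq_2[symmetric] zero_le_divide_iff del: One_nat_def)
  have last: "0 \<le> x m \<longleftrightarrow> 0 \<le> t m" if "m \<ge> 2"
    using that C_pos[of m] by (simp add: xi zero_le_divide_iff)
  have y_ext: "y \<in> {2..m} \<rightarrow>\<^sub>E UNIV"
    by (simp add: y_def)
  have "y \<in> credit_Omega m c \<longleftrightarrow> 0 \<le> x m \<and> (\<forall>i\<in>{1..<m}. x (Suc i) \<le> x i)"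
    using y_ext by (simp only: credit_Omega_def x_def Let_def mem_Collect_eq simp_thms)
  also have "\<dots> \<longleftrightarrow> t \<in> std_simplex {2..m} 1"
  proof (cases "m = 1")
    \<comment> \<open>For \<open>m = 1\<close> the index set is empty and both sides hold: the
      simplex condition reads 0 \<le> 1, and x_1 = 1/c_1 is positive.\<close>
    case True
    then show ?thesis
      using c1 x1 by (simp add: std_simplex_def)
  next
    case False
    with assms(2) have "m \<ge> 2" by simp
    then have sets: "{1..<m} = insert 1 {2..<m}" "{2..m} = insert m {2..<m}"
      by auto
    have "0 \<le> x m \<and> (\<forall>i\<in>{1..<m}. x (Suc i) \<le> x i) \<longleftrightarrow>
        0 \<le> x m \<and> x (Suc 1) \<le> x 1 \<and> (\<forall>i\<in>{2..<m}. x (Suc i) \<le> x i)"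
      unfolding sets(1) by blast
    also have "\<dots> \<longleftrightarrow> 0 \<le> t m \<and> sum t {2..m} \<le> 1 \<and> (\<forall>i\<in>{2..<m}. 0 \<le> t i)"
      using step step1 last \<open>m \<ge> 2\<close> by metis
    also have "\<dots> \<longleftrightarrow> (\<forall>i\<in>{2..m}. 0 \<le> t i) \<and> sum t {2..m} \<le> 1"
      using sets(2) by auto
    finally show ?thesis
      by (simp add: std_simplex_def)
  qed
  finally show ?thesis
    by (simp add: y_def)
qed

lemma credit_Omega_sets [measurable]:
  assumes "m \<ge> 1"
  shows "credit_Omega m c \<in> sets (\<Pi>\<^sub>M i\<in>{2..m}. lborel)"
proof -
  let ?P = "(\<Pi>\<^sub>M i\<in>{2..m}. lborel) :: (nat \<Rightarrow> real) measure"
  define x where "x i y = (y(1 := first_credit m c y)) i" for i and y :: "nat \<Rightarrow> real"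
  have x_meas: "x i \<in> borel_measurable ?P" if "i \<in> {1..m}" for i
  proof (cases "i = 1")
    case True
    then show ?thesis
      unfolding x_def first_credit_def
      by (auto intro!: borel_measurable_times borel_measurable_diff borel_measurable_sum
            measurable_component_singleton)
  next
    case False
    with that have "i \<in> {2..m}" by auto
    with False show ?thesis
      unfolding x_def by (auto intro!: measurable_component_singleton)
  qed
  have "credit_Omega m c = {y \<in> space ?P. 0 \<le> x m y \<and> (\<forall>i\<in>{1..<m}. x (Suc i) y \<le> x i y)}"
    unfolding credit_Omega_def x_def Let_def by (simp only: space_PiM space_lborel space_borel)
  also have "\<dots> \<in> sets ?P"
    using x_meas assms
    by (intro sets.sets_Collect_conj sets.sets_Collect_finite_All borel_measurable_le) auto
  finally show ?thesis .
qed

section \<open>Means under the uniform distribution in the coordinates 2 to m\<close>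

text \<open>The mean is the first moment divided by the volume. The scaling factor \<open>K\<close>
  cancels, and 1/m! over 1/(m-1)! leaves 1/m. Truncation by \<open>ennreal\<close> loses nothing,
  since \<open>y k\<close> is nonnegative on \<open>credit_Omega m c\<close>.\<close>

lemma nn_integral_uniform_credit_Omega:
  fixes c :: "nat \<Rightarrow> nat"
  assumes c: "\<And>i. i \<in> {1..m} \<Longrightarrow> c i > 0" and k: "k \<in> {2..m}"
  shows "(\<integral>\<^sup>+ y. ennreal (y k) \<partial>uniform_measure (\<Pi>\<^sub>M i\<in>{2..m}. lborel) (credit_Omega m c)) =
    ennreal (1 / real m * (\<Sum>j=k..m. 1 / real (\<Sum>i=1..j. c i)))"
proof -
  let ?P = "(\<Pi>\<^sub>M i\<in>{2..m}. lborel) :: (nat \<Rightarrow> real) measure"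
  let ?S = "std_simplex {2..m} 1"
  have m: "m \<ge> 1" using k by auto
  define C where "C j = real (\<Sum>i=1..j. c i)" for j
  define T where "T t = (\<lambda>i\<in>{2..m}. \<Sum>j=i..m. t j / C j)" for t :: "nat \<Rightarrow> real"
  define K where "K = (\<Prod>j=2..m. 1 / C j)"
  have C_pos: "C j > 0" if "j \<in> {2..m}" for j
    unfolding C_def using that c[of 1] m by (intro initial_sum_pos) auto
  have K: "K > 0" "(\<Prod>j=2..m. ennreal (1 / C j)) = ennreal K"
    using C_pos by (auto simp: K_def less_imp_le intro!: prod_pos prod_ennreal)
  have [measurable]: "(\<lambda>y. ennreal (y k)) \<in> borel_measurable ?P"
    using k by (auto intro!: measurable_compose[OF measurable_component_singleton])
  note [measurable] = credit_Omega_sets[OF m]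
  \<comment> \<open>Pulled back along \<open>T\<close>, the domain becomes the simplex, so after the
    shear all integrals are over \<open>?S\<close>.\<close>
  have ind: "indicator (credit_Omega m c) (T t) = (indicator ?S t :: ennreal)" for t
    using credit_Omega_iff_std_simplex[OF m c, where t = t]
    by (simp add: T_def C_def indicator_def)
  have shear: "(\<integral>\<^sup>+ y. f y \<partial>?P) = ennreal K * (\<integral>\<^sup>+ t. f (T t) \<partial>?P)"
    if "f \<in> borel_measurable ?P" for f
    using nn_integral_shear[of 2 m C f] that C_pos m K by (simp add: T_def)
  have "emeasure ?P (credit_Omega m c) = (\<integral>\<^sup>+ y. indicator (credit_Omega m c) y \<partial>?P)"
    by simp
  also have "\<dots> = ennreal K * (\<integral>\<^sup>+ t. indicator ?S t \<partial>?P)"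
    by (subst shear) (auto simp: ind)
  also have "\<dots> = ennreal (K / fact (m - 1))"
    using K m by (subst nn_integral_std_simplex) (auto simp flip: ennreal_mult)
  finally have vol: "emeasure ?P (credit_Omega m c) = ennreal (K / fact (m - 1))" .
  have "(\<integral>\<^sup>+ y. ennreal (y k) * indicator (credit_Omega m c) y \<partial>?P) =
      ennreal K * (\<integral>\<^sup>+ t. ennreal (T t k) * indicator ?S t \<partial>?P)"
    by (subst shear) (auto simp: ind)
  also have "(\<integral>\<^sup>+ t. ennreal (T t k) * indicator ?S t \<partial>?P) =
      (\<integral>\<^sup>+ t. (\<Sum>j=k..m. ennreal (1 / C j) * (ennreal (t j) * indicator ?S t)) \<partial>?P)"
  proof (intro nn_integral_cong)
    fix t
    show "ennreal (T t k) * indicator ?S t =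
        (\<Sum>j=k..m. ennreal (1 / C j) * (ennreal (t j) * indicator ?S t))"
    \<comment> \<open>On the simplex every \<open>t j\<close> is nonnegative, so
      \<open>ennreal\<close> distributes over the tail sum; off it both sides vanish.\<close>
    proof (cases "t \<in> ?S")
      case True
      have "ennreal (T t k) = (\<Sum>j=k..m. ennreal (t j / C j))"
        using True k C_pos by (auto simp: T_def std_simplex_def less_imp_le intro!: sum_ennreal[symmetric])
      also have "\<dots> = (\<Sum>j=k..m. ennreal (1 / C j) * ennreal (t j))"
        using True k C_pos
        by (intro sum.cong) (auto simp: std_simplex_def less_imp_le simp flip: ennreal_mult)
      finally show ?thesis
        using True by simp
    qed simp
  qed
  also have "\<dots> = (\<Sum>j=k..m. ennreal (1 / C j) * (\<integral>\<^sup>+ t. ennreal (t j) * indicator ?S t \<partial>?P))"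
    using k by (subst nn_integral_sum)
      (auto intro!: sum.cong nn_integral_cmult borel_measurable_times measurable_compose[OF measurable_component_singleton])
  also have "\<dots> = (\<Sum>j=k..m. ennreal (1 / C j * (1 / fact m)))"
    using k C_pos
    by (intro sum.cong refl, subst nn_integral_std_simplex_coordinate)
       (auto simp: less_imp_le Suc_diff_Suc simp flip: ennreal_mult)
  also have "\<dots> = ennreal ((\<Sum>j=k..m. 1 / C j) / fact m)"
    using k C_pos by (subst sum_ennreal) (auto simp: less_imp_le sum_divide_distrib)
  also have "ennreal K * \<dots> = ennreal (K * ((\<Sum>j=k..m. 1 / C j) / fact m))"
    using K k C_pos by (intro ennreal_mult[symmetric]) (auto intro!: divide_nonneg_pos sum_nonneg simp: less_imp_le)
  finally have moment: "(\<integral>\<^sup>+ y. ennreal (y k) * indicator (credit_Omega m c) y \<partial>?P) =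
    ennreal (K * ((\<Sum>j=k..m. 1 / C j) / fact m))" .
  have "(\<integral>\<^sup>+ y. ennreal (y k) \<partial>uniform_measure ?P (credit_Omega m c)) =
      ennreal (K * ((\<Sum>j=k..m. 1 / C j) / fact m)) / ennreal (K / fact (m - 1))"
    by (simp add: nn_integral_uniform_measure moment vol)
  also have "\<dots> = ennreal (K * ((\<Sum>j=k..m. 1 / C j) / fact m) / (K / fact (m - 1)))"
    using K k C_pos by (intro divide_ennreal) (auto intro!: mult_nonneg_nonneg divide_nonneg_pos sum_nonneg simp: less_imp_le)
  also have "K * ((\<Sum>j=k..m. 1 / C j) / fact m) / (K / fact (m - 1)) = 1 / real m * (\<Sum>j=k..m. 1 / C j)"
    using K m fact_reduce[of m, where 'a = real] by (simp add: field_simps)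
  finally show ?thesis
    by (simp add: C_def)
qed

section \<open>Transfer to the random vector\<close>

text \<open>The ordering is followed from the positive last coordinate down to index
  \<open>i\<close>. Nonnegativity is what turns the nonnegative integrals into expectations.\<close>

lemma credit_domain_nonneg:
  assumes "x \<in> credit_domain m c" "i \<in> {1..m}"
  shows "x i \<ge> 0"
proof -
  have "i \<le> m" "1 \<le> i" using assms by auto
  then have "x m \<le> x i"
  proof (induction i rule: inc_induct)
    case (step n)
    moreover have "x (Suc n) \<le> x n"
      using assms(1) step.prems step.hyps by (auto simp: credit_domain_def)
    ultimately show ?case by simp
  qed simp
  moreover have "x m > 0"
    using assms(1) by (simp add: credit_domain_def)
  ultimately show ?thesis by simp
qed

theorem theorem1:
  fixes M :: "'a measure" and X :: "'a \<Rightarrow> nat \<Rightarrow> real"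
    and m k :: nat and c :: "nat \<Rightarrow> nat"
  assumes "m \<ge> 1"
    and "\<And>i. i \<in> {1..m} \<Longrightarrow> c i > 0"
    and "prob_space M"
    and "uniform_on_credit_domain M X m c"
    and "1 \<le> k" and "k \<le> m"
  shows "prob_space.expectation M (\<lambda>\<omega>. X \<omega> k) =
           1 / real m * (\<Sum>j=k..m. 1 / real (\<Sum>i=1..j. c i))"
proof -
  interpret prob_space M by fact
  let ?P = "(\<Pi>\<^sub>M i\<in>{2..m}. lborel) :: (nat \<Rightarrow> real) measure"
  define C where "C j = real (\<Sum>i=1..j. c i)" for j
  define R where "R i = 1 / real m * (\<Sum>j=i..m. 1 / C j)" for i
  have X: "X \<in> M \<rightarrow>\<^sub>M (\<Pi>\<^sub>M i\<in>{1..m}. borel)"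
    and dom: "AE \<omega> in M. X \<omega> \<in> credit_domain m c"
    and law: "distr M ?P (\<lambda>\<omega>. restrict (X \<omega>) {2..m}) = uniform_measure ?P (credit_Omega m c)"
    using assms(4) by (auto simp: uniform_on_credit_domain_def)
  have X_meas: "(\<lambda>\<omega>. X \<omega> i) \<in> borel_measurable M" if "i \<in> {1..m}" for i
    by (rule measurable_compose[OF X measurable_component_singleton[OF that]])
  have restr: "(\<lambda>\<omega>. restrict (X \<omega>) {2..m}) \<in> M \<rightarrow>\<^sub>M ?P"
    using X_meas by (intro measurable_restrict) auto
  have C_pos: "C j > 0" if "j \<ge> 1" for j
    unfolding C_def using that assms(1) assms(2)[of 1] by (intro initial_sum_pos) auto
  \<comment> \<open>The law of the restricted vector gives the nonnegative integral of each
    coordinate from 2 on. Its value is finite and the coordinate is almost surely nonnegative, which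
    yields integrability together with the mean.\<close>
  have tail: "integrable M (\<lambda>\<omega>. X \<omega> i) \<and> expectation (\<lambda>\<omega>. X \<omega> i) = R i" if i: "i \<in> {2..m}" for i
  proof -
    have "(\<integral>\<^sup>+ \<omega>. ennreal (X \<omega> i) \<partial>M) = (\<integral>\<^sup>+ \<omega>. ennreal (restrict (X \<omega>) {2..m} i) \<partial>M)"
      using i by simp
    also have "\<dots> = (\<integral>\<^sup>+ y. ennreal (y i) \<partial>distr M ?P (\<lambda>\<omega>. restrict (X \<omega>) {2..m}))"
      using i by (intro nn_integral_distr[symmetric, OF restr])
        (auto intro!: measurable_compose[OF measurable_component_singleton])
    also have "\<dots> = ennreal (R i)"
      unfolding law R_def C_def using i assms(2) by (intro nn_integral_uniform_credit_Omega) auto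
    finally have "(\<integral>\<^sup>+ \<omega>. ennreal (X \<omega> i) \<partial>M) = ennreal (R i)" .
    moreover have "AE \<omega> in M. 0 \<le> X \<omega> i"
      using dom i by (auto elim!: eventually_mono intro: credit_domain_nonneg)
    moreover have "R i \<ge> 0"
      using C_pos i unfolding R_def
      by (auto intro!: divide_nonneg_nonneg sum_nonneg simp: less_imp_le)
    ultimately show ?thesis
      using X_meas[of i] i by (subst (asm) nn_integral_eq_integrable) auto
  qed
  have c1: "c 1 > 0"
    using assms(1,2) by auto
  have split1: "(\<Sum>i=1..m. f i) = f 1 + (\<Sum>i=2..m. f i)" for f :: "nat \<Rightarrow> real"
    using assms(1) by (simp add: sum.atLeast_Suc_atMost numeral_2_eq_2)
  \<comment> \<open>After the swap the weights \<open>c i\<close> add up to \<open>C j\<close>,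
    which cancels \<open>1 / C j\<close> and leaves m ones. This relation later identifies the mean
    of coordinate 1 with \<open>R 1\<close>.\<close>
  have "(\<Sum>i=1..m. real (c i) * R i) = 1 / real m * (\<Sum>i=1..m. real (c i) * (\<Sum>j=i..m. 1 / C j))"
    by (simp add: R_def sum_distrib_left ac_simps)
  also have "\<dots> = 1 / real m * (\<Sum>j=1..m. C j * (1 / C j))"
    unfolding sum_triangle_swap by (simp add: C_def)
  also have "(\<Sum>j=1..m. C j * (1 / C j)) = (\<Sum>j=1..m. 1)"
    using C_pos by (intro sum.cong) (auto simp: less_imp_neq[symmetric])
  finally have R_sum: "(\<Sum>i=1..m. real (c i) * R i) = 1"
    using assms(1) by simp
  \<comment> \<open>The assumed law covers only the coordinates from 2 on, so coordinate 1 is solved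
    from the linear constraint, which holds almost surely. For \<open>m = 1\<close> the sum is
    empty.\<close>
  have "expectation (\<lambda>\<omega>. X \<omega> 1) =
      expectation (\<lambda>\<omega>. 1 / real (c 1) * (1 - (\<Sum>i=2..m. real (c i) * X \<omega> i)))"
  proof (rule integral_cong_AE)
    show "AE \<omega> in M. X \<omega> 1 = 1 / real (c 1) * (1 - (\<Sum>i=2..m. real (c i) * X \<omega> i))"
      using dom
    proof eventually_elim
      case (elim \<omega>)
      then have "real (c 1) * X \<omega> 1 + (\<Sum>i=2..m. real (c i) * X \<omega> i) = 1"
        using split1[of "\<lambda>i. real (c i) * X \<omega> i"] by (simp add: credit_domain_def)
      then show ?case
        using c1 by (simp add: field_simps)
    qed
  qed (use X_meas assms(1) in \<open>auto intro!: borel_measurable_times borel_measurable_diff borel_measurable_sum\<close>)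
  also have "\<dots> = 1 / real (c 1) * (1 - expectation (\<lambda>\<omega>. \<Sum>i=2..m. real (c i) * X \<omega> i))"
    using tail by (subst integral_mult_right_zero, subst Bochner_Integration.integral_diff)
      (auto simp: prob_space intro!: Bochner_Integration.integrable_sum)
  also have "expectation (\<lambda>\<omega>. \<Sum>i=2..m. real (c i) * X \<omega> i) = (\<Sum>i=2..m. real (c i) * R i)"
    using tail by (subst Bochner_Integration.integral_sum) auto
  also have "1 / real (c 1) * (1 - (\<Sum>i=2..m. real (c i) * R i)) = R 1"
    using R_sum c1 unfolding split1 by (simp add: field_simps)
  finally have "expectation (\<lambda>\<omega>. X \<omega> k) = R k"
    using tail[of k] assms(5,6) by (cases "k = 1") auto
  then show ?thesis
    by (simp add: R_def C_def)
qed

end
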